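(* Let $N$ be a positive integer. The unique (up to translation) smallest polyomino which contains $N^2$ instances of the square tetromino is the $(N+1)\times(N+1)$ square polyomino.
   Context: Cells are the unit squares of the square lattice, indexed by integer coordinates $(x,y)$. A polyomino is a finite nonempty edge-connected set of cells; its size is its number of cells; polyominoes are considered up to translation. The square tetromino is the $2\times 2$ block of cells $\{(0,0),(1,0),(0,1),(1,1)\}$. An instance of a shape is a translate of it; an instance in $P$ is one contained in $P$. "Contains $N^2$ instances" means contains at least $N^2$ distinct instances. *)

theory Defs
  imports Main "HOL-Library.Product_Plus"
begin

text \<open>A cell is named by the integer coordinates of its unit square. Polyominoes are represented
  by their concrete cell sets, and ``up to translation'' is made explicit through
  \<open>translation_equiv\<close>.\<close>

type_synonym cell = "int \<times> int"

definition translate :: "cell \<Rightarrow> cell set \<Rightarrow> cell set" where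
  "translate v S = (\<lambda>c. c + v) ` S"

definition translation_equiv :: "cell set \<Rightarrow> cell set \<Rightarrow> bool" where
  "translation_equiv S T \<longleftrightarrow> (\<exists>v. S = translate v T)"

text \<open>Two distinct unit squares share an edge exactly when their coordinates differ by one in one
  direction and agree in the other.\<close>

definition edge_adjacent :: "cell \<Rightarrow> cell \<Rightarrow> bool" where
  "edge_adjacent c d \<longleftrightarrow> \<bar>fst c - fst d\<bar> + \<bar>snd c - snd d\<bar> = 1"

definition edge_connected :: "cell set \<Rightarrow> bool" where
  "edge_connected S \<longleftrightarrow>
     (\<forall>c\<in>S. \<forall>d\<in>S. (c, d) \<in> {(a, b). a \<in> S \<and> b \<in> S \<and> edge_adjacent a b}\<^sup>*)"

definition polyomino :: "cell set \<Rightarrow> bool" where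
  "polyomino P \<longleftrightarrow> finite P \<and> P \<noteq> {} \<and> edge_connected P"

definition square_tetromino :: "cell set" where
  "square_tetromino = {(0, 0), (1, 0), (0, 1), (1, 1)}"

definition square_polyomino :: "nat \<Rightarrow> cell set" where
  "square_polyomino n = {0..<int n} \<times> {0..<int n}"

definition instances :: "cell set \<Rightarrow> cell set \<Rightarrow> cell set set" where
  "instances T P = {Q. translation_equiv Q T \<and> Q \<subseteq> P}"

text \<open>For finite \<open>P\<close> the set of instances is finite, so \<open>card\<close> is the true number of distinct
  instances; the definition is only used for polyominoes.\<close>

definition contains_instances :: "nat \<Rightarrow> cell set \<Rightarrow> cell set \<Rightarrow> bool" where
  "contains_instances k T P \<longleftrightarrow> k \<le> card (instances T P)"

definition smallest_polyomino_containing :: "nat \<Rightarrow> cell set \<Rightarrow> cell set \<Rightarrow> bool" where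
  "smallest_polyomino_containing k T P \<longleftrightarrow>
     is_arg_min card (\<lambda>Q. polyomino Q \<and> contains_instances k T Q) P"

end

theory Submission
  imports Defs
begin

text \<open>Let \<open>A\<close> be the set of positions of the instances in \<open>P\<close>, with projections \<open>X\<close> and \<open>Y\<close>.
  Adding to \<open>A\<close> its translate by \<open>(1, 0)\<close> creates at least one new cell in each of the \<open>card Y\<close> rows,
  and then adding the translate by \<open>(0, 1)\<close> creates at least one new cell in each of the at least
  \<open>card X + 1\<close> columns. Hence \<open>card P \<ge> card A + card X + card Y + 1\<close>, while
  \<open>card X * card Y \<ge> card A \<ge> N\<^sup>2\<close> forces \<open>card X + card Y \<ge> 2 * N\<close>.
  In the case of equality, \<open>A = X \<times> Y\<close> with \<open>card X = card Y = N\<close>, and \<open>X\<close> and \<open>Y\<close> are intervals.\<close>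

text \<open>Instances are sets of cells, whereas their translation vectors are cells again, so they
  can be projected, shifted and compared with \<open>P\<close> itself.\<close>

definition positions :: "cell set \<Rightarrow> cell set \<Rightarrow> cell set" where
  "positions T P = {v. translate v T \<subseteq> P}"

lemma positions_square_tetromino_iff:
  "(x, y) \<in> positions square_tetromino P \<longleftrightarrow>
     (x, y) \<in> P \<and> (x + 1, y) \<in> P \<and> (x, y + 1) \<in> P \<and> (x + 1, y + 1) \<in> P"
  by (auto simp: positions_def translate_def square_tetromino_def add.commute)

lemma inj_translate_square_tetromino: "inj (\<lambda>v. translate v square_tetromino)"
proof (rule injI)
  fix v w assume eq: "translate v square_tetromino = translate w square_tetromino"
  \<comment> \<open>The lower left cell of the tetromino is the origin, so coordinatewise minima
    recover the translation vector.\<close>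
  have *: "Min (fst ` translate u square_tetromino) = fst u"
          "Min (snd ` translate u square_tetromino) = snd u" for u
    by (auto simp: translate_def square_tetromino_def)
  show "v = w"
    using *[of v] *[of w] eq by (simp add: prod_eq_iff)
qed

lemma card_instances_square_tetromino:
  "card (instances square_tetromino P) = card (positions square_tetromino P)"
proof -
  have "instances square_tetromino P
      = (\<lambda>v. translate v square_tetromino) ` positions square_tetromino P"
    by (auto simp: instances_def translation_equiv_def positions_def)
  then show ?thesis
    by (simp add: card_image inj_on_subset[OF inj_translate_square_tetromino])
qed

lemma card_Un_shift_right:
  assumes "finite (A :: cell set)"
  shows "card A + card (snd ` A) \<le> card (A \<union> (\<lambda>c. c + (1, 0)) ` A)"
proof -
  let ?row = "\<lambda>y. {x. (x, y) \<in> A}"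
  \<comment> \<open>The witness in row \<open>y\<close> is the cell just right of its rightmost
    cell.\<close>
  let ?new = "\<lambda>y. (Max (?row y) + 1, y)"
  have fin: "finite (?row y)" for y
    by (rule finite_subset[of _ "fst ` A"]) (use assms in force)+
  have "?new y \<in> (\<lambda>c. c + (1, 0)) ` A - A" if "y \<in> snd ` A" for y
  proof -
    have "?row y \<noteq> {}" using that by auto
    then have "(Max (?row y), y) \<in> A" using Max_in[OF fin] by auto
    moreover have "?new y \<notin> A"
      using Max_ge[OF fin, of "Max (?row y) + 1" y] by auto
    ultimately show ?thesis by force
  qed
  then have "?new ` snd ` A \<subseteq> (\<lambda>c. c + (1, 0)) ` A - A" by blast
  then have "card (?new ` snd ` A) \<le> card ((\<lambda>c. c + (1, 0)) ` A - A)"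
    using assms by (intro card_mono) auto
  moreover have "card (?new ` snd ` A) = card (snd ` A)"
    by (intro card_image inj_onI) simp
  moreover have "card (A \<union> (\<lambda>c. c + (1, 0)) ` A) = card A + card ((\<lambda>c. c + (1, 0)) ` A - A)"
    using assms card_Un_disjoint[of A "(\<lambda>c. c + (1, 0)) ` A - A"] by auto
  ultimately show ?thesis by simp
qed

lemma card_Un_shift_up:
  assumes "finite (A :: cell set)"
  shows "card A + card (fst ` A) \<le> card (A \<union> (\<lambda>c. c + (0, 1)) ` A)"
proof -
  \<comment> \<open>Swapping coordinates turns the upward shift into the shift to the right.\<close>
  have "prod.swap ` A \<union> (\<lambda>c. c + (1, 0)) ` prod.swap ` A
      = prod.swap ` (A \<union> (\<lambda>c. c + (0, 1)) ` A)"
    by (simp add: image_Un image_image prod.swap_def)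
  then show ?thesis
    using card_Un_shift_right[of "prod.swap ` A"] assms
    by (simp add: card_image image_image)
qed

text \<open>Applied to a projection of \<open>A\<close>: the first shift enlarges it by at least
  one, which is the source of the final + 1 in the bound.\<close>

lemma card_Un_succ:
  assumes "finite (X :: int set)" "X \<noteq> {}"
  shows "card X + 1 \<le> card (X \<union> (\<lambda>x. x + 1) ` X)"
proof -
  have "insert (Max X + 1) X \<subseteq> X \<union> (\<lambda>x. x + 1) ` X" using assms by auto
  then have "card (insert (Max X + 1) X) \<le> card (X \<union> (\<lambda>x. x + 1) ` X)"
    using assms by (intro card_mono) auto
  moreover have "Max X + 1 \<notin> X" using Max_ge[OF assms(1), of "Max X + 1"] by auto
  ultimately show ?thesis using assms by simp
qed

text \<open>If the shift adds only one point, that point is \<open>Max X + 1\<close>. Hence below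
  its maximum \<open>X\<close> is closed under successor, and induction from \<open>Min X\<close>
  leaves no gap.\<close>

lemma interval_if_card_Un_succ_le:
  assumes "finite (X :: int set)" "X \<noteq> {}"
    and le: "card (X \<union> (\<lambda>x. x + 1) ` X) \<le> card X + 1"
  shows "X = {Min X..<Min X + int (card X)}"
proof -
  have "Max X + 1 \<notin> X" using Max_ge[OF assms(1), of "Max X + 1"] by auto
  then have "card (insert (Max X + 1) X) = card X + 1" using assms by simp
  then have eq: "insert (Max X + 1) X = X \<union> (\<lambda>x. x + 1) ` X"
    using assms by (intro card_seteq) auto
  have "x \<in> X" if "Min X \<le> x" "x \<le> Max X" for x
    using that
  proof (induction x rule: int_ge_induct)
    case base
    then show ?case using assms by simp
  next
    case (step i)
    then have "i + 1 \<in> insert (Max X + 1) X" unfolding eq by auto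
    then show ?case using step by auto
  qed
  then have X: "X = {Min X..Max X}"
    using Min_le[OF assms(1)] Max_ge[OF assms(1)] by (meson atLeastAtMost_iff equalityI subsetI)
  have "card {Min X..Max X} = nat (Max X + 1 - Min X)" by simp
  then have "card X = nat (Max X + 1 - Min X)" by (simp only: X[symmetric])
  moreover have "Min X \<le> Max X" using assms by simp
  ultimately have "Min X + int (card X) = Max X + 1" by simp
  then have "{Min X..Max X} = {Min X..<Min X + int (card X)}" by auto
  with X show ?thesis by (rule trans)
qed

text \<open>The shifted projections stay unevaluated because the equality case needs upper bounds on
  their cardinalities. Shifting right first gives the bound for \<open>X\<close>, shifting up first
  the one for \<open>Y\<close>.\<close>

lemma card_ge_positions:
  assumes "finite P"
  defines "A \<equiv> positions square_tetromino P"
  defines "X \<equiv> fst ` A" and "Y \<equiv> snd ` A"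
  shows "card A + card Y + card (X \<union> (\<lambda>x. x + 1) ` X) \<le> card P"
    and "card A + card X + card (Y \<union> (\<lambda>y. y + 1) ` Y) \<le> card P"
proof -
  have "A \<subseteq> P" by (auto simp: A_def positions_square_tetromino_iff)
  then have fin: "finite A" using assms finite_subset by blast
  let ?R = "A \<union> (\<lambda>c. c + (1, 0)) ` A" and ?U = "A \<union> (\<lambda>c. c + (0, 1)) ` A"
  have sub: "?R \<union> (\<lambda>c. c + (0, 1)) ` ?R \<subseteq> P" "?U \<union> (\<lambda>c. c + (1, 0)) ` ?U \<subseteq> P"
    by (auto simp: A_def positions_square_tetromino_iff)
  have proj: "fst ` ?R = X \<union> (\<lambda>x. x + 1) ` X" "snd ` ?U = Y \<union> (\<lambda>y. y + 1) ` Y"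
    by (simp_all add: X_def Y_def image_Un image_image)
  show "card A + card Y + card (X \<union> (\<lambda>x. x + 1) ` X) \<le> card P"
    using card_Un_shift_right[OF fin] card_Un_shift_up[of ?R] card_mono[OF assms(1) sub(1)] fin
    unfolding proj Y_def by simp
  show "card A + card X + card (Y \<union> (\<lambda>y. y + 1) ` Y) \<le> card P"
    using card_Un_shift_up[OF fin] card_Un_shift_right[of ?U] card_mono[OF assms(1) sub(2)] fin
    unfolding proj X_def by simp
qed

lemma sum_ge_if_prod_ge_square:
  fixes m n N :: nat
  assumes "N\<^sup>2 \<le> m * n"
  shows "2 * N \<le> m + n"
proof -
  have "4 * (m * n) \<le> (m + n)\<^sup>2"
    \<comment> \<open>This is (m + n)^2 - 4mn = (m - n)^2, taken over the integers since subtraction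
      on \<open>nat\<close> truncates.\<close>
    using sum_squares_ge_zero[of "int m - int n" 0]
    by (simp add: power2_eq_square algebra_simps flip: of_nat_le_iff[where 'a = int])
  then have "(2 * N)\<^sup>2 \<le> (m + n)\<^sup>2"
    using assms by (simp add: power_mult_distrib)
  then show ?thesis by (rule power2_le_imp_le) simp
qed

lemma eq_if_sum_eq_prod_ge_square:
  fixes m n N :: nat
  assumes "N\<^sup>2 \<le> m * n" "m + n = 2 * N"
  shows "m = N" "n = N"
proof -
  have n: "int n = 2 * int N - int m" using assms(2) by simp
  have "(int N)\<^sup>2 \<le> int m * int n" using assms(1) by (metis of_nat_le_iff of_nat_mult of_nat_power)
  \<comment> \<open>With n = 2N - m, the product mn equals N^2 - (N - m)^2.\<close>
  then have "(int N - int m)\<^sup>2 \<le> 0" unfolding n by (simp add: power2_eq_square algebra_simps)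
  then show "m = N" by simp
  then show "n = N" using assms(2) by simp
qed

lemma card_ge_if_square_positions:
  assumes "finite P" "N \<ge> 1" and N: "N\<^sup>2 \<le> card (positions square_tetromino P)"
  shows "(N + 1)\<^sup>2 \<le> card P"
    and "card P \<le> (N + 1)\<^sup>2 \<Longrightarrow>
      \<exists>a b. P = {a..<a + int (N + 1)} \<times> {b..<b + int (N + 1)}"
proof -
  define A where "A = positions square_tetromino P"
  define X where "X = fst ` A"
  define Y where "Y = snd ` A"
  note bounds = card_ge_positions[OF assms(1), folded A_def, folded X_def Y_def]
  have "A \<subseteq> P" by (auto simp: A_def positions_square_tetromino_iff)
  then have fin: "finite A" using assms finite_subset by blast
  have "A \<noteq> {}" using N assms(2) by (auto simp flip: A_def)
  then have XY: "finite X" "X \<noteq> {}" "finite Y" "Y \<noteq> {}" using fin by (auto simp: X_def Y_def)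
  have AXY: "A \<subseteq> X \<times> Y" by (force simp: X_def Y_def)
  then have "card A \<le> card X * card Y" using XY by (metis card_cartesian_product card_mono finite_cartesian_product)
  then have prod: "N\<^sup>2 \<le> card X * card Y" using N by (simp add: A_def)
  then have sum: "2 * N \<le> card X + card Y" by (rule sum_ge_if_prod_ge_square)
  have sq: "(N + 1)\<^sup>2 = N\<^sup>2 + 2 * N + 1" by (simp add: power2_eq_square)
  have A: "N\<^sup>2 \<le> card A" using N by (simp add: A_def)
  note succ = card_Un_succ[OF XY(1,2)] card_Un_succ[OF XY(3,4)]
  show "(N + 1)\<^sup>2 \<le> card P" using bounds(1) succ sum A unfolding sq by linarith
  assume le: "card P \<le> (N + 1)\<^sup>2"
  \<comment> \<open>Now every inequality in the chain for the lower bound is tight.\<close>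
  have "card X + card Y = 2 * N" "card A = N\<^sup>2"
    using bounds(1) succ sum A le unfolding sq by linarith+
  note card = eq_if_sum_eq_prod_ge_square[OF prod this(1)] this(2)
  have "card (X \<union> (\<lambda>x. x + 1) ` X) \<le> card X + 1" "card (Y \<union> (\<lambda>y. y + 1) ` Y) \<le> card Y + 1"
    using bounds le card unfolding sq by linarith+
  then obtain a b where X: "X = {a..<a + int N}" and Y: "Y = {b..<b + int N}"
    using interval_if_card_Un_succ_le XY card by metis
  \<comment> \<open>The inclusion \<open>A \<subseteq> X \<times> Y\<close> is between finite sets
    that both have N^2 elements.\<close>
  have "A = X \<times> Y"
    using AXY XY card by (intro card_seteq) (auto simp: power2_eq_square)
  then have mem: "(x, y) \<in> P" "(x + 1, y) \<in> P" "(x, y + 1) \<in> P" "(x + 1, y + 1) \<in> P"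
    if "a \<le> x" "x < a + int N" "b \<le> y" "y < b + int N" for x y
    using that positions_square_tetromino_iff[of x y P] by (auto simp: A_def X Y)
  let ?S = "{a..<a + int (N + 1)} \<times> {b..<b + int (N + 1)}"
  have "?S \<subseteq> P"
  proof clarify
    fix x y assume "x \<in> {a..<a + int (N + 1)}" "y \<in> {b..<b + int (N + 1)}"
    then show "(x, y) \<in> P"
      \<comment> \<open>A cell in the last column or row belongs to the instance one step to the
        left or below; such an instance exists because \<open>N \<ge> 1\<close>.\<close>
      using mem[of x y] mem[of "x - 1" y] mem[of x "y - 1"] mem[of "x - 1" "y - 1"] assms(2)
      by (cases "x < a + int N"; cases "y < b + int N") auto
  qed
  moreover have "card ?S = (N + 1)\<^sup>2"
    by (simp add: card_cartesian_product power2_eq_square nat_add_distrib)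
  ultimately have "?S = P"
    using le assms(1) by (intro card_seteq) auto
  then show "\<exists>a b. P = {a..<a + int (N + 1)} \<times> {b..<b + int (N + 1)}" by blast
qed

lemma translation_equiv_square_polyomino_iff:
  "translation_equiv P (square_polyomino n) \<longleftrightarrow>
     (\<exists>a b. P = {a..<a + int n} \<times> {b..<b + int n})"
proof -
  have "translate (a, b) (square_polyomino n) = {a..<a + int n} \<times> {b..<b + int n}" for a b
  proof (intro equalityI subsetI)
    fix c assume "c \<in> {a..<a + int n} \<times> {b..<b + int n}"
    then have "c - (a, b) \<in> square_polyomino n" by (auto simp: square_polyomino_def)
    then have "c - (a, b) + (a, b) \<in> translate (a, b) (square_polyomino n)"
      unfolding translate_def by (rule imageI)
    then show "c \<in> translate (a, b) (square_polyomino n)" by simp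
  qed (auto simp: translate_def square_polyomino_def)
  then show ?thesis by (simp add: translation_equiv_def split_paired_Ex)
qed

text \<open>Every cell is reached from the corner \<open>(a, b)\<close> by going up the first column
  and then along a row; symmetry of adjacency joins two such paths.\<close>

lemma edge_connected_rectangle: "edge_connected ({a..<a'} \<times> {b..<b'})"
proof -
  let ?P = "{a..<a'} \<times> {b..<b'}"
  let ?E = "{(c, d). c \<in> ?P \<and> d \<in> ?P \<and> edge_adjacent c d}"
  have "sym ?E" by (auto simp: sym_def edge_adjacent_def abs_minus_commute)
  then have sym: "(d, c) \<in> ?E\<^sup>*" if "(c, d) \<in> ?E\<^sup>*" for c d
    using that by (meson sym_rtrancl symD)
  have row: "((a, y), (x, y)) \<in> ?E\<^sup>*" if "a \<le> x" "x < a'" "b \<le> y" "y < b'" for x y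
    using that
  proof (induction x rule: int_ge_induct)
    case (step x)
    then have "((x, y), (x + 1, y)) \<in> ?E" by (auto simp: edge_adjacent_def)
    with step show ?case by (auto intro: rtrancl_into_rtrancl)
  qed simp
  have column: "((a, b), (a, y)) \<in> ?E\<^sup>*" if "a < a'" "b \<le> y" "y < b'" for y
    using that(2,3)
  proof (induction y rule: int_ge_induct)
    case (step y)
    then have "((a, y), (a, y + 1)) \<in> ?E" using that(1) by (auto simp: edge_adjacent_def)
    with step show ?case by (auto intro: rtrancl_into_rtrancl)
  qed simp
  have corner: "((a, b), c) \<in> ?E\<^sup>*" if "c \<in> ?P" for c
    using that row[of "fst c" "snd c"] column[of "snd c"] by (auto intro: rtrancl_trans)
  show ?thesis
    unfolding edge_connected_def using corner sym by (meson rtrancl_trans)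
qed

lemma square_contains_instances:
  fixes a b :: int
  shows "contains_instances (N\<^sup>2) square_tetromino
    ({a..<a + int (N + 1)} \<times> {b..<b + int (N + 1)})"
proof -
  have "positions square_tetromino ({a..<a + int (N + 1)} \<times> {b..<b + int (N + 1)})
      = {a..<a + int N} \<times> {b..<b + int N}"
    by (auto simp: positions_square_tetromino_iff)
  then show ?thesis
    by (simp add: contains_instances_def card_instances_square_tetromino card_cartesian_product
        power2_eq_square)
qed

theorem theorem4p3:
  fixes N :: nat
  assumes "N \<ge> 1"
  shows "\<forall>P. smallest_polyomino_containing (N\<^sup>2) square_tetromino P \<longleftrightarrow>
             translation_equiv P (square_polyomino (N + 1))"
proof -
  let ?S = "\<lambda>a b. {a..<a + int (N + 1)} \<times> {b..<b + int (N + 1)}"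
  let ?valid = "\<lambda>Q. polyomino Q \<and> contains_instances (N\<^sup>2) square_tetromino Q"
  have valid: "?valid (?S a b)" for a b
    using edge_connected_rectangle square_contains_instances
    by (simp add: polyomino_def)
  have card: "card (?S a b) = (N + 1)\<^sup>2" for a b
    by (simp add: card_cartesian_product power2_eq_square nat_add_distrib)
  have ge: "(N + 1)\<^sup>2 \<le> card Q" if "?valid Q" for Q
    using that card_ge_if_square_positions(1)[OF _ assms]
    by (simp add: polyomino_def contains_instances_def card_instances_square_tetromino)
  have eq: "\<exists>a b. Q = ?S a b" if "?valid Q" "card Q \<le> (N + 1)\<^sup>2" for Q
    using that card_ge_if_square_positions(2)[OF _ assms]
    by (simp add: polyomino_def contains_instances_def card_instances_square_tetromino)
  have "is_arg_min card ?valid P \<longleftrightarrow> (\<exists>a b. P = ?S a b)" for P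
  proof
    assume "is_arg_min card ?valid P"
    \<comment> \<open>Minimality only excludes strictly smaller competitors, so it is tested against
      one concrete square, the one at the origin.\<close>
    then have "?valid P" "\<not> card (?S 0 0) < card P"
      using valid[of 0 0] unfolding is_arg_min_def by blast+
    then show "\<exists>a b. P = ?S a b" using eq unfolding card by simp
  next
    assume "\<exists>a b. P = ?S a b"
    then show "is_arg_min card ?valid P"
      using valid ge card unfolding is_arg_min_def by (metis linorder_not_less)
  qed
  then show ?thesis
    unfolding smallest_polyomino_containing_def translation_equiv_square_polyomino_iff by blast
qed

end
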